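(* $\Gamma_4(10) \le 9.292^\circ$.
   Context: For distinct points $A,B,C \in \mathbb{R}^2$, $\angle ABC \in [0^\circ,180^\circ]$ denotes the (unsigned) angle at $B$ between the vectors $\vec{BA}$ and $\vec{BC}$, measured in degrees (collinear triples give $0^\circ$ or $180^\circ$). For integers $n \ge k \ge 3$, define $$\Gamma_k(n) = \sup\{\gamma : \forall\, S \subset \mathbb{R}^2 \text{ with } |S|=n,\ \exists\, T \subseteq S \text{ with } |T|=k \text{ such that } |\angle ABC-90^\circ| \ge \gamma \text{ for all distinct } A,B,C \in T\}.$$ *)

theory Defs
  imports "HOL-Analysis.Analysis"
begin

text \<open>
  The unsigned angle at \<open>B\<close> between the vectors \<open>A - B\<close> and \<open>C - B\<close>, in degrees, with values in
  \<open>[0, 180]\<close>. It is only meaningful for \<open>A \<noteq> B\<close> and \<open>C \<noteq> B\<close>.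
\<close>

definition angle_deg :: "real ^ 2 \<Rightarrow> real ^ 2 \<Rightarrow> real ^ 2 \<Rightarrow> real" where
  "angle_deg A B C =
     arccos (((A - B) \<bullet> (C - B)) / (norm (A - B) * norm (C - B))) * 180 / pi"

text \<open>
  \<open>Gamma_ang k n\<close> is \<open>\<Gamma>\<^sub>k(n)\<close>, intended for \<open>n \<ge> k \<ge> 3\<close>. For such \<open>k\<close> and \<open>n\<close> the set below
  contains \<open>0\<close> and is bounded above by \<open>90\<close>, so that the real-valued \<open>Sup\<close> is the actual
  supremum; moreover \<open>card S = n\<close> forces \<open>S\<close> to be finite since \<open>n > 0\<close>, and likewise for \<open>T\<close>.
\<close>

definition Gamma_ang :: "nat \<Rightarrow> nat \<Rightarrow> real" where
  "Gamma_ang k n =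
     Sup {\<gamma>. \<forall>S :: (real ^ 2) set. card S = n \<longrightarrow>
            (\<exists>T \<subseteq> S. card T = k \<and>
               (\<forall>A\<in>T. \<forall>B\<in>T. \<forall>C\<in>T. A \<noteq> B \<and> B \<noteq> C \<and> A \<noteq> C \<longrightarrow>
                  \<bar>angle_deg A B C - 90\<bar> \<ge> \<gamma>))}"

end

theory Submission
  imports Defs
begin

text \<open>
  Since \<open>sin 9.292\<degree> > 1 / sqrt 39\<close>, it suffices to exhibit ten points such that any four of them
  contain three distinct points \<open>A\<close>, \<open>B\<close>, \<open>C\<close> with \<open>39 (u \<bullet> v)\<^sup>2 \<le> |u|\<^sup>2 |v|\<^sup>2\<close> for \<open>u = A - B\<close>,
  \<open>v = C - B\<close>. The integer configuration below was found by simulated annealing; each of its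
  four-point subsets has an angle within \<open>9.13\<degree>\<close> of a right angle, and this leaves room for the
  crude rational bounds.
\<close>

text \<open>The sine is increasing on [-pi/2, pi/2], so pi may be replaced by 3.14 from below; the
  cubic Taylor polynomial minus its error bound is then a rational lower bound.\<close>

lemma sin_9_292_deg: "sqrt (1 / 39) \<le> sin (9.292 * pi / 180)"
proof -
  define t :: real where "t = 9.292 * 3.14 / 180"
  have "t \<le> 9.292 * pi / 180" "9.292 * pi / 180 \<le> pi / 2"
    using pi_approx by (auto simp: t_def)
  moreover have "0 \<le> t"
    by (simp add: t_def)
  ultimately have mono: "sin t \<le> sin (9.292 * pi / 180)"
    by (intro sin_monotone_2pi_le) auto
  have "\<bar>sin t - (\<Sum>i<4. sin_coeff i * t ^ i)\<bar> \<le> inverse (fact 4) * \<bar>t\<bar> ^ 4"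
    by (rule Maclaurin_sin_bound)
  moreover have "(\<Sum>i<4. sin_coeff i * t ^ i) = t - t ^ 3 / 6"
    by (simp add: sin_coeff_def lessThan_nat_numeral lessThan_Suc fact_numeral)
  ultimately have "\<bar>sin t - (t - t ^ 3 / 6)\<bar> \<le> t ^ 4 / 24"
    using \<open>0 \<le> t\<close> by (simp add: fact_numeral)
  then have "t - t ^ 3 / 6 - t ^ 4 / 24 \<le> sin t"
    by linarith
  moreover have "sqrt (1 / 39) \<le> t - t ^ 3 / 6 - t ^ 4 / 24"
    \<comment> \<open>Squaring removes the root and leaves a comparison of explicit
      rationals.\<close>
    by (rule real_le_lsqrt) (simp_all add: t_def power2_eq_square eval_nat_numeral)
  ultimately show ?thesis
    using mono by linarith
qed

lemma angle_deg_near_right: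
  assumes "39 * ((A - B) \<bullet> (C - B))\<^sup>2 \<le> ((A - B) \<bullet> (A - B)) * ((C - B) \<bullet> (C - B))"
  shows "\<bar>angle_deg A B C - 90\<bar> \<le> 9.292"
proof -
  define c where "c = ((A - B) \<bullet> (C - B)) / (norm (A - B) * norm (C - B))"
  have "c\<^sup>2 \<le> 1 / 39"
  \<comment> \<open>If a vector vanishes, division by zero makes \<open>c\<close> equal to 0, so the
    bound persists.\<close>
  proof (cases "A = B \<or> C = B")
    case False
    then have "0 < ((A - B) \<bullet> (A - B)) * ((C - B) \<bullet> (C - B))"
      by simp
    then show ?thesis
      using assms
      by (simp add: c_def power_divide power_mult_distrib power2_norm_eq_inner pos_divide_le_eq mult.commute)
  qed (auto simp: c_def)
  then have c: "\<bar>c\<bar> \<le> sin (9.292 * pi / 180)"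
    using sin_9_292_deg real_le_rsqrt[of "\<bar>c\<bar>" "1 / 39"] by simp
  then have "\<bar>c\<bar> \<le> 1"
    using sin_le_one order_trans by blast
  \<comment> \<open>As arccos c = pi/2 - arcsin c, the deviation from a right angle is |arcsin c|,
    here bounded from both sides by monotonicity of arcsin.\<close>
  moreover have "\<bar>arcsin c\<bar> \<le> 9.292 * pi / 180"
    using c \<open>\<bar>c\<bar> \<le> 1\<close> arcsin_le_arcsin[of c "sin (9.292 * pi / 180)"]
      arcsin_le_arcsin[of "- sin (9.292 * pi / 180)" c] sin_le_one[of "9.292 * pi / 180"]
    by (simp add: abs_le_iff arcsin_minus arcsin_sin)
  ultimately show ?thesis
    by (simp add: angle_deg_def flip: c_def)
      (simp add: arccos_arcsin_eq abs_le_iff field_simps)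
qed

definition points :: "(int \<times> int) list" where
  "points = [(191,87), (149,54), (8,236), (164,0), (136,4),
             (136,52), (166,1), (17,243), (176,94), (0,229)]"

text \<open>With denominators cleared and roots squared away, the cosine bound is pure integer
  arithmetic and can be decided by evaluation.\<close>

fun near_right :: "int \<times> int \<Rightarrow> int \<times> int \<Rightarrow> int \<times> int \<Rightarrow> bool" where
  "near_right (a, b) (p, q) (c, d) \<longleftrightarrow>
     39 * ((a - p) * (c - p) + (b - q) * (d - q))\<^sup>2 \<le>
     ((a - p)\<^sup>2 + (b - q)\<^sup>2) * ((c - p)\<^sup>2 + (d - q)\<^sup>2)"

definition embed :: "int \<times> int \<Rightarrow> real ^ 2" where
  "embed z = vector [of_int (fst z), of_int (snd z)]"

lemma inj_embed: "inj embed"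
  by (auto simp: inj_def embed_def vec_eq_iff forall_2 prod_eq_iff)

lemma near_right_angle_deg:
  assumes "near_right x y z"
  shows "\<bar>angle_deg (embed x) (embed y) (embed z) - 90\<bar> \<le> 9.292"
proof (rule angle_deg_near_right)
  obtain a b p q c d where "x = (a, b)" "y = (p, q)" "z = (c, d)"
    by (metis surj_pair)
  with assms show "39 * ((embed x - embed y) \<bullet> (embed z - embed y))\<^sup>2 \<le>
      ((embed x - embed y) \<bullet> (embed x - embed y)) * ((embed z - embed y) \<bullet> (embed z - embed y))"
    \<comment> \<open>Both sides of the goal are real casts of the integers that
      \<open>near_right\<close> compares.\<close>
    using of_int_le_iff[of "39 * ((a - p) * (c - p) + (b - q) * (d - q))\<^sup>2"
        "((a - p)\<^sup>2 + (b - q)\<^sup>2) * ((c - p)\<^sup>2 + (d - q)\<^sup>2)", where 'a = real]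
    by (simp add: embed_def inner_vec_def sum_2 power2_eq_square)
qed

text \<open>A finite check: of the 1024 subsequences, the 210 of length four are searched for a
  suitable triple.\<close>

lemma four_points_near_right:
  "\<forall>xs \<in> set (filter (\<lambda>xs. length xs = 4) (subseqs points)).
     \<exists>x \<in> set xs. \<exists>y \<in> set xs. \<exists>z \<in> set xs. x \<noteq> y \<and> y \<noteq> z \<and> x \<noteq> z \<and> near_right x y z"
  by code_simp

text \<open>Carries the check from lists to sets: every subset is the set of some subsequence, and
  distinctness of the entries turns cardinality into length.\<close>

lemma four_subset_near_right:
  assumes "T \<subseteq> set points" "card T = 4"
  obtains x y z where "x \<in> T" "y \<in> T" "z \<in> T" "x \<noteq> y" "y \<noteq> z" "x \<noteq> z" "near_right x y z"
proof -
  obtain xs where xs: "xs \<in> set (subseqs points)" "set xs = T"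
    using assms(1) subset_subseqs by (metis imageE)
  moreover have "distinct points"
    by (simp add: points_def)
  ultimately have "distinct xs"
    by (blast intro: subseqs_distinctD)
  then have "length xs = 4"
    using assms(2) xs(2) distinct_card by fastforce
  with xs(1) have "\<exists>x \<in> set xs. \<exists>y \<in> set xs. \<exists>z \<in> set xs.
      x \<noteq> y \<and> y \<noteq> z \<and> x \<noteq> z \<and> near_right x y z"
    using four_points_near_right by simp
  with xs(2) that show thesis
    by blast
qed

theorem proposition2p2:
  shows "Gamma_ang 4 10 \<le> 9.292"
  unfolding Gamma_ang_def
proof (rule cSup_least, goal_cases)
  case 1
  \<comment> \<open>\<open>cSup_least\<close> needs a nonempty set; 0 is admissible because absolute
    values are nonnegative.\<close>
  have "\<exists>T \<subseteq> S. card T = 4" if "card S = 10" for S :: "(real ^ 2) set"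
    using that obtain_subset_with_card_n[of 4 S] by auto
  then have "0 \<in> {\<gamma>. \<forall>S :: (real ^ 2) set. card S = 10 \<longrightarrow>
      (\<exists>T \<subseteq> S. card T = 4 \<and> (\<forall>A\<in>T. \<forall>B\<in>T. \<forall>C\<in>T. A \<noteq> B \<and> B \<noteq> C \<and> A \<noteq> C \<longrightarrow>
        \<gamma> \<le> \<bar>angle_deg A B C - 90\<bar>))}"
    by simp
  then show ?case
    by blast
next
  case (2 \<gamma>)
  \<comment> \<open>An arbitrary admissible \<gamma> is tested on the embedded configuration, which
    keeps ten points by injectivity.\<close>
  have "card (embed ` set points) = 10"
    using card_image[OF inj_on_subset[OF inj_embed subset_UNIV], of "set points"]
    by (simp add: points_def)
  from 2[unfolded mem_Collect_eq, THEN spec, THEN mp, OF this]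
  obtain T where T: "T \<subseteq> embed ` set points" "card T = 4"
    and angles: "\<And>A B C. A \<in> T \<Longrightarrow> B \<in> T \<Longrightarrow> C \<in> T \<Longrightarrow> A \<noteq> B \<and> B \<noteq> C \<and> A \<noteq> C \<Longrightarrow>
      \<gamma> \<le> \<bar>angle_deg A B C - 90\<bar>"
    by blast
  \<comment> \<open>Pulling \<open>T\<close> back to integer points makes the finite check
    applicable.\<close>
  obtain U where U: "U \<subseteq> set points" "T = embed ` U"
    using T(1) by (auto simp: subset_image_iff)
  have "card U = 4"
    using T(2) U(2) card_image[OF inj_on_subset[OF inj_embed subset_UNIV], of U] by simp
  with U(1) obtain x y z
    where "x \<in> U" "y \<in> U" "z \<in> U" "x \<noteq> y" "y \<noteq> z" "x \<noteq> z" "near_right x y z"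
    by (rule four_subset_near_right)
  then have "\<gamma> \<le> \<bar>angle_deg (embed x) (embed y) (embed z) - 90\<bar>"
    using angles U(2) inj_embed by (auto simp: inj_eq)
  with near_right_angle_deg[OF \<open>near_right x y z\<close>] show ?case
    by linarith
qed

end
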